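(* Let $f:\operatorname{dom}(f)\subseteq\mathbb{R}^n\to\mathbb{R}$ be $\mathcal{C}^3$ on the open ball $B(x^0,\overline{\Delta})$, and denote by $L$ the Lipschitz constant of $\nabla^2 f$ on this ball. Let $\mathcal{X}=\langle x^0,x^1,\ldots,x^m\rangle$ be an ordered set of distinct points in $\mathbb{R}^n$ with radius $\Delta<\overline{\Delta}$. Suppose $\operatorname{rank} S=m<n$, where $S=S(\mathcal{X})$, and let $\mathbb{U}=\operatorname{span} S$ be the linear span of the columns of $S$. Define $\widehat{S}=S/\Delta$. Then $$\|\nabla^c f(\mathcal{X})-\nabla f_{\mathbb{U}}(x^0)\|=\|\operatorname{Proj}_{\mathbb{U}}\nabla^c f(\mathcal{X})-\operatorname{Proj}_{\mathbb{U}}\nabla f(x^0)\|\le\frac{L\sqrt{m}}{6}\left\|(\widehat{S}^\top)^\dagger\right\|\Delta^2.$$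
   Context: Vectors carry the Euclidean norm and matrices the induced operator norm. $A^\dagger$ denotes the Moore--Penrose pseudoinverse of a matrix $A$. For an ordered set of points $\mathcal{X}=\langle x^0,x^1,\ldots,x^m\rangle$ write $x^i=x^0+d^i$, $i=1,\ldots,m$ ($m\ge 1$). Its radius is $\Delta=\max_{1\le i\le m}\|d^i\|$, and $S(\mathcal{X})=[d^1\ \cdots\ d^m]\in\mathbb{R}^{n\times m}$. The generalized centred simplex gradient of $f$ over $\mathcal{X}$ is $\nabla^c f(\mathcal{X})=(S(\mathcal{X})^\top)^\dagger\,\delta^c_f(\mathcal{X})\in\mathbb{R}^n$, where $\delta^c_f(\mathcal{X})\in\mathbb{R}^m$ has $i$-th entry $\tfrac12\big(f(x^0+d^i)-f(x^0-d^i)\big)$. $\operatorname{Proj}_{\mathbb{U}}$ is the orthogonal projection onto the subspace $\mathbb{U}$, and $f_{\mathbb{U}}(y)=f\big(x^0+\operatorname{Proj}_{\mathbb{U}}(y-x^0)\big)$; $\nabla f_{\mathbb{U}}(x^0)$ is the gradient of $f_{\mathbb{U}}$ at $x^0$. "$L$ is the Lipschitz constant of $\nabla^2 f$" means $\|\nabla^2 f(x)-\nabla^2 f(y)\|\le L\|x-y\|$ for all $x,y\in B(x^0,\overline{\Delta})$ (such a finite $L$ is assumed to exist). *)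

theory Defs
  imports "HOL-Analysis.Analysis"
begin

(* Intended for open S only: differentiability is two-sided, and for open S this is the usual
   class of k times continuously differentiable functions (all iterated directional
   derivatives up to order k exist and are continuous on S). *)
primrec Ck_on :: "nat \<Rightarrow> ('a::real_normed_vector \<Rightarrow> real) \<Rightarrow> 'a set \<Rightarrow> bool" where
  "Ck_on 0 f S \<longleftrightarrow> continuous_on S f"
| "Ck_on (Suc k) f S \<longleftrightarrow>
     (\<forall>x\<in>S. f differentiable (at x)) \<and>
     (\<forall>v. Ck_on k (\<lambda>x. frechet_derivative f (at x) v) S)"

definition gradient :: "(real^'n \<Rightarrow> real) \<Rightarrow> real^'n \<Rightarrow> real^'n" where
  "gradient f x = (THE D. GDERIV f x :> D)"

definition hessian :: "(real^'n \<Rightarrow> real) \<Rightarrow> real^'n \<Rightarrow> real^'n^'n" where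
  "hessian f x = jacobian (gradient f) (at x)"

text \<open>The Moore--Penrose pseudoinverse, via the four Penrose conditions.\<close>

definition is_pinv :: "real^'c^'r \<Rightarrow> real^'r^'c \<Rightarrow> bool" where
  "is_pinv A X \<longleftrightarrow>
     A ** X ** A = A \<and> X ** A ** X = X \<and>
     transpose (A ** X) = A ** X \<and> transpose (X ** A) = X ** A"

definition pinv :: "real^'c^'r \<Rightarrow> real^'r^'c" where
  "pinv A = (THE X. is_pinv A X)"

definition orth_proj :: "(real^'n) set \<Rightarrow> real^'n \<Rightarrow> real^'n" where
  "orth_proj U x = (THE p. p \<in> U \<and> (\<forall>u\<in>U. orthogonal (x - p) u))"

definition f_restr :: "(real^'n \<Rightarrow> real) \<Rightarrow> real^'n \<Rightarrow> (real^'n) set \<Rightarrow> real^'n \<Rightarrow> real" where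
  "f_restr f x0 U y = f (x0 + orth_proj U (y - x0))"

text \<open>An ordered set of points \<open>\<langle>x\<^sup>0, x\<^sup>1, \<dots>, x\<^sup>m\<rangle>\<close> is given by its base point \<open>x0\<close> and the
  family \<open>x\<close> of the remaining points, indexed by a finite type \<open>'m\<close> with \<open>CARD('m) = m\<close>
  (so \<open>m \<ge> 1\<close> automatically).\<close>

definition distinct_points :: "real^'n \<Rightarrow> ('m::finite \<Rightarrow> real^'n) \<Rightarrow> bool" where
  "distinct_points x0 x \<longleftrightarrow> inj x \<and> x0 \<notin> range x"

definition radius :: "real^'n \<Rightarrow> ('m::finite \<Rightarrow> real^'n) \<Rightarrow> real" where
  "radius x0 x = Max (range (\<lambda>i. norm (x i - x0)))"

(* In a matrix of type real^'m^'n the row index has type 'n and the column index type 'm. *)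
definition S_matrix :: "real^'n \<Rightarrow> ('m::finite \<Rightarrow> real^'n) \<Rightarrow> real^'m^'n" where
  "S_matrix x0 x = (\<chi> r i. (x i - x0) $ r)"

definition delta_c :: "(real^'n \<Rightarrow> real) \<Rightarrow> real^'n \<Rightarrow> ('m::finite \<Rightarrow> real^'n) \<Rightarrow> real^'m" where
  "delta_c f x0 x = (\<chi> i. (f (x0 + (x i - x0)) - f (x0 - (x i - x0))) / 2)"

definition centred_gradient :: "(real^'n \<Rightarrow> real) \<Rightarrow> real^'n \<Rightarrow> ('m::finite \<Rightarrow> real^'n) \<Rightarrow> real^'n" where
  "centred_gradient f x0 x = pinv (transpose (S_matrix x0 x)) *v delta_c f x0 x"

end

theory Submission
  imports Defs
begin

text \<open>
  Let \<open>\<delta>\<close> be the vector of symmetric difference quotients along the columns \<open>d\<^sup>i\<close> of \<open>S\<close>.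
  Since \<open>S\<close> has independent columns, the Gram matrix \<open>S\<^sup>T S\<close> is invertible and the pseudoinverse of
  \<open>S\<^sup>T\<close> is \<open>X = S (S\<^sup>T S)\<^sup>-\<^sup>1\<close>. Two consequences carry the linear algebra: \<open>X S\<^sup>T\<close> is the orthogonal
  projection onto the column span \<open>U\<close>, and \<open>X\<close> maps into \<open>U\<close>. The centred gradient \<open>X \<delta>\<close> therefore
  already lies in \<open>U\<close>. By the chain rule and self-adjointness of the projection, the gradient of
  the restricted function is the projected gradient of \<open>f\<close>, which gives the asserted equality
  (lemmas \<open>orth_proj_span_columns\<close> and \<open>orth_proj_span_columns_selfadjoint\<close>). Moreover the error
  equals \<open>X \<delta> - X S\<^sup>T \<nabla>f(x\<^sup>0) = X (\<delta> - S\<^sup>T \<nabla>f(x\<^sup>0))\<close>.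

  The \<open>i\<close>-th entry of \<open>\<delta> - S\<^sup>T \<nabla>f(x\<^sup>0)\<close> is the error of a symmetric difference quotient in the
  direction \<open>d\<^sup>i\<close>. The symmetry cancels the second-order Taylor term, and the Lipschitz bound on
  the Hessian controls the remainder by \<open>L/6 \<parallel>d\<^sup>i\<parallel>\<^sup>3 \<le> L/6 \<Delta>\<^sup>3\<close> (lemma
  \<open>centred_difference_error\<close>). A vector with \<open>m\<close> such entries has norm at most
  \<open>\<surd>m L/6 \<Delta>\<^sup>3\<close>. One factor \<open>\<Delta>\<close> is absorbed on passing from \<open>X\<close> to the pseudoinverse of the
  rescaled matrix, which is \<open>\<Delta> X\<close>.
\<close>

section \<open>The pseudoinverse of a matrix with full row rank\<close>

text \<open>
  \<open>A X\<close> and \<open>A Y\<close> are symmetric projections with \<open>A X = (A Y) (A X)\<close>; transposing reverses the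
  product to \<open>(A X) (A Y) = A Y\<close>. The same argument gives \<open>X A = Y A\<close>, and \<open>X = X A X\<close> is determined
  by these two products.
\<close>

lemma is_pinv_unique:
  fixes A :: "real^'c^'r"
  assumes X: "is_pinv A X" and Y: "is_pinv A Y"
  shows "X = Y"
proof -
  note P = X[unfolded is_pinv_def] Y[unfolded is_pinv_def]
  have AX: "A ** X = A ** Y"
  proof -
    have "A ** X = transpose ((A ** Y) ** (A ** X))"
      using P by (metis matrix_mul_assoc)
    also have "\<dots> = (A ** X) ** (A ** Y)"
      using P by (simp add: matrix_transpose_mul)
    also have "\<dots> = A ** Y"
      using P by (simp add: matrix_mul_assoc)
    finally show ?thesis .
  qed
  have XA: "X ** A = Y ** A"
  proof -
    have "X ** A = transpose ((X ** A) ** (Y ** A))"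
      using P by (metis matrix_mul_assoc)
    also have "\<dots> = (Y ** A) ** (X ** A)"
      using P by (simp add: matrix_transpose_mul)
    also have "\<dots> = Y ** A"
      using P by (metis matrix_mul_assoc)
    finally show ?thesis .
  qed
  have "X = X ** (A ** X)" using P by (simp add: matrix_mul_assoc)
  also have "\<dots> = (X ** A) ** Y" by (simp add: AX matrix_mul_assoc)
  also have "\<dots> = Y" using P by (simp add: XA)
  finally show ?thesis .
qed

lemma pinv_eqI: "is_pinv A X \<Longrightarrow> pinv A = X"
  unfolding pinv_def by (blast intro: is_pinv_unique the_equality)

lemma is_pinv_scaleR:
  fixes A :: "real^'c^'r"
  assumes "is_pinv A X" and "c \<noteq> 0"
  shows "is_pinv (c *\<^sub>R A) ((1 / c) *\<^sub>R X)"
proof -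
  have l: "(k *\<^sub>R B) ** C = k *\<^sub>R (B ** C)" for k and B :: "real^'x^'y" and C :: "real^'z^'x"
    by (simp only: scalar_matrix_assoc)
  have r: "B ** (k *\<^sub>R C) = k *\<^sub>R (B ** C)" for k and B :: "real^'x^'y" and C :: "real^'z^'x"
    by (simp only: matrix_scalar_ac scalar_matrix_assoc)
  show ?thesis
    using assms by (simp add: is_pinv_def l r transpose_scalar)
qed

text \<open>
  \<open>v \<bullet> S\<^sup>T S v = \<parallel>S v\<parallel>\<^sup>2\<close>, so a kernel vector of the Gram matrix is a kernel vector of \<open>S\<close>.
\<close>

lemma invertible_Gram:
  fixes S :: "real^'m^'n"
  assumes "inj ((*v) S)"
  shows "invertible (transpose S ** S)"
proof -
  have "v = 0" if "(transpose S ** S) *v v = 0" for v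
  proof -
    have "(S *v v) \<bullet> (S *v v) = v \<bullet> ((transpose S ** S) *v v)"
      by (metis dot_lmul_matrix inner_commute matrix_vector_mul_assoc vector_transpose_matrix transpose_matrix_vector)
    then have "S *v v = S *v 0" using that by simp
    then show ?thesis using assms by (blast dest: injD)
  qed
  then show ?thesis
    by (metis invertible_left_inverse matrix_left_invertible_ker)
qed

text \<open>
  The witness is \<open>S (S\<^sup>T S)\<^sup>-\<^sup>1\<close>; it is a right inverse of \<open>S\<^sup>T\<close>, so three of the Penrose conditions
  are immediate, and the last one follows from the symmetry of the inverse Gram matrix.
\<close>

lemma pinv_transpose_full_column_rank:
  fixes S :: "real^'m^'n"
  assumes "inj ((*v) S)"
  shows "is_pinv (transpose S) (pinv (transpose S))"
    and "transpose S ** pinv (transpose S) = mat 1"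
    and "pinv (transpose S) *v w \<in> range ((*v) S)"
proof -
  let ?K = "transpose S ** S"
  obtain G where G: "?K ** G = mat 1" "G ** ?K = mat 1"
    using invertible_Gram[OF assms] by (auto simp: invertible_def)
  define X where "X = S ** G"
  have AX: "transpose S ** X = mat 1"
    by (simp add: X_def matrix_mul_assoc G)
  have symG: "transpose G = G"
  proof -
    have "transpose G ** ?K = transpose (?K ** G)"
      by (simp add: matrix_transpose_mul)
    then have "transpose G ** ?K = mat 1" by (simp add: G)
    then have "transpose G ** (?K ** G) = G" by (simp add: matrix_mul_assoc)
    then show ?thesis by (simp add: G)
  qed
  have P: "is_pinv (transpose S) X"
    unfolding is_pinv_def
  proof (intro conjI)
    show "transpose (X ** transpose S) = X ** transpose S"
      by (simp add: X_def matrix_transpose_mul symG matrix_mul_assoc)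
    show "X ** transpose S ** X = X"
      by (simp add: AX flip: matrix_mul_assoc)
  qed (simp_all add: AX)
  then have X: "pinv (transpose S) = X" by (rule pinv_eqI)
  show "is_pinv (transpose S) (pinv (transpose S))" "transpose S ** pinv (transpose S) = mat 1"
    using P AX X by simp_all
  show "pinv (transpose S) *v w \<in> range ((*v) S)"
    by (simp add: X X_def flip: matrix_vector_mul_assoc)
qed

section \<open>The orthogonal projection onto the column span\<close>

lemma orth_proj_eqI:
  assumes "subspace U" and "p \<in> U" and "\<And>u. u \<in> U \<Longrightarrow> orthogonal (x - p) u"
  shows "orth_proj U x = p"
  unfolding orth_proj_def
proof (rule the_equality)
  fix q assume q: "q \<in> U \<and> (\<forall>u\<in>U. orthogonal (x - q) u)"
  then have "q - p \<in> U" using assms subspace_diff by blast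
  then have "(x - p) \<bullet> (q - p) = 0" "(x - q) \<bullet> (q - p) = 0"
    using q assms by (auto simp: orthogonal_def)
  then have "(q - p) \<bullet> (q - p) = 0" by (simp add: inner_diff_left)
  then show "q = p" by simp
qed (use assms in auto)

text \<open>
  The residual \<open>y - X S\<^sup>T y\<close> is killed by \<open>S\<^sup>T\<close> because \<open>S\<^sup>T X = I\<close>, that is, it is orthogonal to all
  columns of \<open>S\<close>. For \<open>y = X w\<close> the same identity makes the projection act trivially.
\<close>

lemma orth_proj_span_columns:
  fixes S :: "real^'m^'n"
  assumes "inj ((*v) S)"
  shows "orth_proj (span (columns S)) y = pinv (transpose S) *v (transpose S *v y)"
    and "orth_proj (span (columns S)) (pinv (transpose S) *v w) = pinv (transpose S) *v w"
proof -
  let ?X = "pinv (transpose S)"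
  note AX = pinv_transpose_full_column_rank(2)[OF assms]
  have range: "u \<in> span (columns S) \<longleftrightarrow> u \<in> range ((*v) S)" for u
  proof -
    have "columns S \<subseteq> range ((*v) S)"
      by (auto simp: columns_def simp flip: matrix_vector_mult_basis)
    then have "span (columns S) \<subseteq> range ((*v) S)"
      by (intro span_minimal linear_subspace_image) auto
    then show ?thesis using matrix_vector_mult_in_columnspace by blast
  qed
  have mem: "?X *v w \<in> span (columns S)" for w
    unfolding range by (rule pinv_transpose_full_column_rank(3)[OF assms])
  show proj: "orth_proj (span (columns S)) y = ?X *v (transpose S *v y)" for y
  proof (rule orth_proj_eqI)
    fix u assume "u \<in> span (columns S)"
    then obtain v where u: "u = S *v v" unfolding range by blast
    have "transpose S *v (y - ?X *v (transpose S *v y)) = 0"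
      by (simp add: matrix_vector_mult_diff_distrib matrix_vector_mul_assoc matrix_mul_assoc AX)
    moreover have "(y - ?X *v (transpose S *v y)) \<bullet> u
        = (transpose S *v (y - ?X *v (transpose S *v y))) \<bullet> v"
      unfolding u by (simp flip: dot_lmul_matrix)
    ultimately show "orthogonal (y - ?X *v (transpose S *v y)) u"
      by (simp add: orthogonal_def)
  qed (auto intro: mem)
  show "orth_proj (span (columns S)) (?X *v w) = ?X *v w"
    by (simp add: proj matrix_vector_mul_assoc AX flip: matrix_mul_assoc)
qed

text \<open>
  This is the Penrose condition that \<open>X S\<^sup>T\<close> is symmetric. It is what moves the projection
  from the direction to the gradient in the chain rule for the restricted function.
\<close>

lemma orth_proj_span_columns_selfadjoint:
  fixes S :: "real^'m^'n"
  assumes "inj ((*v) S)"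
  shows "orth_proj (span (columns S)) y \<bullet> z = y \<bullet> orth_proj (span (columns S)) z"
proof -
  have "transpose (pinv (transpose S) ** transpose S) = pinv (transpose S) ** transpose S"
    using pinv_transpose_full_column_rank(1)[OF assms] by (simp add: is_pinv_def)
  then show ?thesis
    by (metis (no_types) orth_proj_span_columns(1)[OF assms] dot_lmul_matrix matrix_vector_mul_assoc transpose_matrix_vector)
qed

section \<open>Gradient and Hessian of a twice differentiable function\<close>

lemma GDERIV_unique:
  assumes "GDERIV f x :> D" and "GDERIV f x :> E"
  shows "D = E"
proof -
  have "h \<bullet> D = h \<bullet> E" for h
    using has_derivative_unique[OF assms[unfolded gderiv_def]] by metis
  then show ?thesis by (metis vector_eq_ldot inner_commute)
qed

lemma gradient_eqI: "GDERIV f x :> D \<Longrightarrow> gradient f x = D"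
  unfolding gradient_def by (blast intro: GDERIV_unique the_equality)

lemma frechet_derivative_representation:
  fixes f :: "real^'n \<Rightarrow> real"
  assumes "f differentiable (at x)"
  shows "GDERIV f x :> (\<Sum>b\<in>Basis. frechet_derivative f (at x) b *\<^sub>R b)"
proof -
  let ?f' = "frechet_derivative f (at x)"
  have f': "(f has_derivative ?f') (at x)"
    using assms frechet_derivative_works by blast
  then have lin: "linear ?f'" by (rule has_derivative_linear)
  have "?f' = (\<lambda>h. h \<bullet> (\<Sum>b\<in>Basis. ?f' b *\<^sub>R b))"
  proof
    fix h
    have "?f' h = ?f' (\<Sum>b\<in>Basis. (h \<bullet> b) *\<^sub>R b)" by (simp add: euclidean_representation)
    also have "\<dots> = (\<Sum>b\<in>Basis. (h \<bullet> b) * ?f' b)"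
      by (simp add: linear_sum[OF lin] linear_scale[OF lin])
    finally show "?f' h = h \<bullet> (\<Sum>b\<in>Basis. ?f' b *\<^sub>R b)"
      by (simp add: inner_sum_right mult.commute)
  qed
  with f' show ?thesis unfolding gderiv_def by (rule back_subst)
qed

text \<open>
  The gradient is assembled from the directional derivatives along the basis vectors, each
  differentiable on the open set \<open>T\<close>; since the formula holds on a neighbourhood of \<open>y\<close>, the
  gradient inherits their differentiability, and its Jacobian is an honest derivative.
\<close>

lemma C2_gradient_hessian:
  fixes f :: "real^'n \<Rightarrow> real"
  assumes "Ck_on (Suc (Suc k)) f T" and "open T" and "y \<in> T"
  shows "GDERIV f y :> gradient f y"
    and "(gradient f has_derivative (*v) (hessian f y)) (at y)"
proof -
  have diff: "f differentiable (at z)" if "z \<in> T" for z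
    using assms(1) that by simp
  have rep: "gradient f z = (\<Sum>b\<in>Basis. frechet_derivative f (at z) b *\<^sub>R b)" if "z \<in> T" for z
    by (intro gradient_eqI frechet_derivative_representation diff that)
  show "GDERIV f y :> gradient f y"
    using frechet_derivative_representation[OF diff] rep \<open>y \<in> T\<close> by simp
  have "(\<lambda>z. \<Sum>b\<in>Basis. frechet_derivative f (at z) b *\<^sub>R b) differentiable (at y)"
    using assms(1,3) by (intro differentiable_sum differentiable_scaleR) auto
  then have "gradient f differentiable (at y)"
    using rep \<open>open T\<close> \<open>y \<in> T\<close>
    unfolding differentiable_def
    by (metis (mono_tags, lifting) has_derivative_transform_within_open)
  then show "(gradient f has_derivative (*v) (hessian f y)) (at y)"
    by (simp add: hessian_def jacobian_works)
qed

section \<open>The error of a symmetric difference\<close>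

text \<open>
  Integration of a monomial bound, done without integrals: \<open>c t\<^sup>n\<^sup>+\<^sup>1 \<plusminus> g t\<close> vanishes at \<open>0\<close> and is
  nondecreasing.
\<close>

lemma power_bound_from_derivative:
  fixes g g' :: "real \<Rightarrow> real"
  assumes g: "\<And>t. 0 \<le> t \<Longrightarrow> t \<le> 1 \<Longrightarrow> (g has_real_derivative g' t) (at t)"
    and g': "\<And>t. 0 \<le> t \<Longrightarrow> t \<le> 1 \<Longrightarrow> \<bar>g' t\<bar> \<le> c * real (Suc n) * t ^ n"
    and "g 0 = 0" and t: "0 \<le> t" "t \<le> 1"
  shows "\<bar>g t\<bar> \<le> c * t ^ Suc n"
proof -
  have "0 \<le> c * t ^ Suc n - s * g t" if "\<bar>s\<bar> = 1" for s
  proof -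
    let ?h = "\<lambda>u. c * u ^ Suc n - s * g u"
    have "?h 0 \<le> ?h t"
    proof (rule DERIV_nonneg_imp_nondecreasing[OF t(1)])
      fix u assume u: "0 \<le> u" "u \<le> t"
      then have u1: "u \<le> 1" using t by simp
      have "(?h has_real_derivative (c * real (Suc n) * u ^ n - s * g' u)) (at u)"
        by (rule derivative_eq_intros g u u1 refl | simp)+
      moreover have "s * g' u \<le> \<bar>g' u\<bar>"
        using that by (metis abs_ge_self abs_mult mult_1)
      ultimately show "\<exists>y. (?h has_real_derivative y) (at u) \<and> 0 \<le> y"
        using g'[OF u(1) u1] by (intro exI conjI) auto
    qed
    then show ?thesis using \<open>g 0 = 0\<close> by simp
  qed
  from this[of 1] this[of "-1"] show ?thesis by simp
qed

text \<open>
  Along the segment, let \<open>a t\<close> be the error for the step \<open>t d\<close>. Both \<open>a\<close> and its derivative \<open>b\<close>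
  vanish at \<open>0\<close>, and the second derivative \<open>c\<close> is half the difference of the quadratic forms of \<open>H\<close>
  at the points \<open>x0 + t d\<close> and \<open>x0 - t d\<close>, which are \<open>2 t \<parallel>d\<parallel>\<close> apart. Hence
  \<open>\<bar>c t\<bar> \<le> L t \<parallel>d\<parallel>\<^sup>3\<close>, and integrating twice produces the factor \<open>1/6\<close>.
\<close>

lemma centred_difference_error:
  fixes f :: "real^'n \<Rightarrow> real" and H :: "real^'n \<Rightarrow> real^'n^'n"
  assumes f: "\<And>y. y \<in> ball x0 r \<Longrightarrow> GDERIV f y :> g y"
    and g: "\<And>y. y \<in> ball x0 r \<Longrightarrow> (g has_derivative (*v) (H y)) (at y)"
    and H: "\<And>y z. y \<in> ball x0 r \<Longrightarrow> z \<in> ball x0 r \<Longrightarrow>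
          onorm ((*v) (H y - H z)) \<le> L * norm (y - z)"
    and d: "norm d < r"
  shows "\<bar>(f (x0 + d) - f (x0 - d)) / 2 - d \<bullet> g x0\<bar> \<le> L / 6 * norm d ^ 3"
proof -
  have mem: "x0 + s *\<^sub>R d \<in> ball x0 r" if "\<bar>s\<bar> \<le> 1" for s
    using that d mult_left_le_one_le[of "norm d" "\<bar>s\<bar>"] by (simp add: dist_norm)
  have line: "((\<lambda>t. x0 + (s * t) *\<^sub>R d) has_derivative (\<lambda>h. (s * h) *\<^sub>R d)) (at t)" for s t
    by (auto intro!: derivative_eq_intros)
  \<comment> \<open>Taking \<open>s = 1\<close> and \<open>s = -1\<close> covers the two halves of the segment.\<close>
  have Df: "((\<lambda>t. f (x0 + (s * t) *\<^sub>R d)) has_real_derivative s * (d \<bullet> g (x0 + (s * t) *\<^sub>R d))) (at t)"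
    if "\<bar>s * t\<bar> \<le> 1" for s t
    using has_derivative_compose[OF line f[OF mem[OF that], unfolded gderiv_def]]
    by (simp add: has_field_derivative_def mult_commute_abs mult_ac)
  have Dg: "((\<lambda>t. d \<bullet> g (x0 + (s * t) *\<^sub>R d)) has_real_derivative
      s * (d \<bullet> (H (x0 + (s * t) *\<^sub>R d) *v d))) (at t)"
    if "\<bar>s * t\<bar> \<le> 1" for s t
    using has_derivative_inner_right[OF has_derivative_compose[OF line g[OF mem[OF that]]], of d]
    by (simp add: has_field_derivative_def matrix_vector_mult_scaleR mult_commute_abs mult_ac)
  define a where "a = (\<lambda>t. (f (x0 + (1 * t) *\<^sub>R d) - f (x0 + (-1 * t) *\<^sub>R d)) / 2 - t * (d \<bullet> g x0))"
  define b where "b = (\<lambda>t. (d \<bullet> g (x0 + (1 * t) *\<^sub>R d) + d \<bullet> g (x0 + (-1 * t) *\<^sub>R d)) / 2 - d \<bullet> g x0)"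
  define c where "c = (\<lambda>t. (d \<bullet> (H (x0 + (1 * t) *\<^sub>R d) *v d) - d \<bullet> (H (x0 + (-1 * t) *\<^sub>R d) *v d)) / 2)"
  have Da: "(a has_real_derivative b t) (at t)" if "0 \<le> t" "t \<le> 1" for t
    unfolding a_def b_def
    by (rule derivative_eq_intros Df refl | use that in simp)+
  have Db: "(b has_real_derivative c t) (at t)" if "0 \<le> t" "t \<le> 1" for t
    unfolding b_def c_def
    by (rule derivative_eq_intros Dg refl | use that in simp)+
  \<comment> \<open>Constants are written in the form that the integration lemma consumes: exponent \<open>1\<close>, then \<open>2\<close>.\<close>
  have c: "\<bar>c t\<bar> \<le> L / 2 * norm d ^ 3 * real (Suc 1) * t ^ 1" if t: "0 \<le> t" "t \<le> 1" for t
  proof -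
    let ?y = "x0 + (1 * t) *\<^sub>R d" and ?z = "x0 + (-1 * t) *\<^sub>R d"
    have "2 * \<bar>c t\<bar> = \<bar>d \<bullet> ((H ?y - H ?z) *v d)\<bar>"
      by (simp add: c_def inner_diff_right matrix_vector_mult_diff_rdistrib)
    also have "\<dots> \<le> norm d * norm ((H ?y - H ?z) *v d)"
      by (rule Cauchy_Schwarz_ineq2)
    also have "\<dots> \<le> norm d * (onorm ((*v) (H ?y - H ?z)) * norm d)"
      by (intro mult_left_mono onorm) auto
    also have "\<dots> \<le> norm d * (L * norm (?y - ?z) * norm d)"
      using t by (intro mult_left_mono mult_right_mono H mem) auto
    also have "?y - ?z = (2 * t) *\<^sub>R d"
      by (simp add: algebra_simps flip: scaleR_add_left)
    finally show ?thesis
      using t by (simp add: power3_eq_cube mult_ac)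
  qed
  have "b 0 = 0" "a 0 = 0" by (simp_all add: a_def b_def)
  have b: "\<bar>b t\<bar> \<le> L / 6 * norm d ^ 3 * real (Suc 2) * t ^ 2" if "0 \<le> t" "t \<le> 1" for t
    using power_bound_from_derivative[of b c, OF Db c \<open>b 0 = 0\<close> that]
    by (simp add: power2_eq_square)
  from power_bound_from_derivative[of a b, OF Da b \<open>a 0 = 0\<close>, of 1]
  show ?thesis by (simp add: a_def)
qed

section \<open>The error bound for the generalized centred simplex gradient\<close>

theorem theorem3p6:
  fixes f :: "real^'n \<Rightarrow> real"
    and x0 :: "real^'n"
    and x :: "'m::finite \<Rightarrow> real^'n"
    and S Shat :: "real^'m^'n"
    and U :: "(real^'n) set"
    and L \<Delta> \<Delta>bar :: real
  assumes C3: "Ck_on 3 f (ball x0 \<Delta>bar)"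
    and Lipschitz: "\<And>y z. y \<in> ball x0 \<Delta>bar \<Longrightarrow> z \<in> ball x0 \<Delta>bar \<Longrightarrow>
          onorm ((*v) (hessian f y - hessian f z)) \<le> L * norm (y - z)"
    and dist: "distinct_points x0 x"
    and Delta: "\<Delta> = radius x0 x"
    and radius: "\<Delta> < \<Delta>bar"
    and S: "S = S_matrix x0 x"
    and rank: "rank S = CARD('m)"
    and m_less_n: "CARD('m) < CARD('n)"
    and U: "U = span (columns S)"
    and Shat: "Shat = (1 / \<Delta>) *\<^sub>R S"
  shows "norm (centred_gradient f x0 x - gradient (f_restr f x0 U) x0)
           = norm (orth_proj U (centred_gradient f x0 x) - orth_proj U (gradient f x0))
       \<and> norm (orth_proj U (centred_gradient f x0 x) - orth_proj U (gradient f x0))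
           \<le> L * sqrt (real CARD('m)) / 6 * onorm ((*v) (pinv (transpose Shat))) * \<Delta>\<^sup>2"
proof -
  let ?G = "gradient f x0" and ?C = "centred_gradient f x0 x"
  let ?A = "transpose S" and ?P = "orth_proj U"
  define X where "X = pinv ?A"
  define e where "e = delta_c f x0 x - ?A *v ?G"
  have inj: "inj ((*v) S)" using rank by (simp add: full_rank_injective)
  note pinv = pinv_transpose_full_column_rank[OF inj]
  note proj = orth_proj_span_columns[OF inj, folded U X_def]
  have norm_d: "norm (x i - x0) \<le> \<Delta>" for i
    unfolding Delta radius_def by (rule Max_ge) auto
  \<comment> \<open>The index type is inhabited, so some displacement is nonzero and the radius is positive.\<close>
  have "0 < norm (x undefined - x0)"
    using dist by (auto simp: distinct_points_def)
  with norm_d[of undefined] have "0 < \<Delta>" by linarith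
  then have x0: "x0 \<in> ball x0 \<Delta>bar" using radius by simp
  have C2: "Ck_on (Suc (Suc 1)) f (ball x0 \<Delta>bar)"
    using C3 by (simp add: numeral_3_eq_3)
  note deriv = C2_gradient_hessian[OF C2 open_ball]
  have C: "?C = X *v delta_c f x0 x"
    by (simp add: centred_gradient_def X_def S)

  have "GDERIV (f_restr f x0 U) x0 :> ?P ?G"
  proof -
    have P: "?P = (*v) (X ** ?A)"
      by (simp add: fun_eq_iff proj matrix_vector_mul_assoc del: transpose_matrix_vector)
    have "((\<lambda>y. x0 + ?P (y - x0)) has_derivative ?P) (at x0)"
      unfolding P
      by (auto intro!: derivative_eq_intros bounded_linear.has_derivative[OF matrix_vector_mul_bounded_linear])
    moreover have "(f has_derivative (\<lambda>h. h \<bullet> ?G)) (at (x0 + ?P (x0 - x0)))"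
      using deriv(1)[OF x0] by (simp add: P gderiv_def)
    ultimately have "(f_restr f x0 U has_derivative (\<lambda>h. ?P h \<bullet> ?G)) (at x0)"
      unfolding f_restr_def by (rule has_derivative_compose)
    then show ?thesis
      by (simp add: gderiv_def orth_proj_span_columns_selfadjoint[OF inj] U)
  qed
  then have restr: "gradient (f_restr f x0 U) x0 = ?P ?G" by (rule gradient_eqI)
  have PC: "?P ?C = ?C" by (simp only: C proj(2))
  have diff: "?P ?C - ?P ?G = X *v e"
    unfolding PC by (simp only: C proj(1) e_def matrix_vector_mult_diff_distrib)

  \<comment> \<open>The Lipschitz inequality at two distinct points of the ball forces the sign of \<open>L\<close>,
      which the estimate of each displacement by the radius requires.\<close>
  have "0 \<le> L"
  proof -
    have "0 \<le> L * norm (x0 - y)" if "y \<in> ball x0 \<Delta>bar" for y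
      using Lipschitz[OF x0 that] onorm_pos_le[of "(*v) (hessian f x0 - hessian f y)"] by auto
    from this[of "x undefined"] norm_d[of undefined] radius \<open>0 < norm (x undefined - x0)\<close>
    show ?thesis by (auto simp: dist_norm norm_minus_commute zero_le_mult_iff)
  qed
  have e: "\<bar>e $ i\<bar> \<le> L / 6 * \<Delta> ^ 3" for i
  proof -
    have "norm (x i - x0) < \<Delta>bar" using norm_d[of i] radius by linarith
    then have "\<bar>(f (x0 + (x i - x0)) - f (x0 - (x i - x0))) / 2 - (x i - x0) \<bullet> ?G\<bar>
        \<le> L / 6 * norm (x i - x0) ^ 3"
      by (intro centred_difference_error[where r = \<Delta>bar and H = "hessian f"] deriv Lipschitz)
    moreover have "e $ i = (f (x0 + (x i - x0)) - f (x0 - (x i - x0))) / 2 - (x i - x0) \<bullet> ?G"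
      by (simp add: e_def delta_c_def S S_matrix_def vector_matrix_mult_def inner_vec_def mult.commute)
    ultimately have "\<bar>e $ i\<bar> \<le> L / 6 * norm (x i - x0) ^ 3" by simp
    also have "\<dots> \<le> L / 6 * \<Delta> ^ 3"
      using norm_d[of i] \<open>0 \<le> L\<close> by (intro mult_left_mono power_mono) auto
    finally show ?thesis .
  qed
  have norm_e: "norm e \<le> sqrt (real CARD('m)) * (L / 6 * \<Delta> ^ 3)"
  proof -
    have "norm e \<le> L2_set (\<lambda>i::'m. L / 6 * \<Delta> ^ 3) UNIV"
      unfolding norm_vec_def by (intro L2_set_mono) (use e in auto)
    then show ?thesis
      using \<open>0 \<le> L\<close> \<open>0 < \<Delta>\<close> by (simp add: L2_set_constant)
  qed
  have "pinv (transpose Shat) = \<Delta> *\<^sub>R X"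
    using is_pinv_scaleR[OF pinv(1), of "1 / \<Delta>"] \<open>0 < \<Delta>\<close>
    by (intro pinv_eqI) (simp add: Shat transpose_scalar X_def)
  then have onorm_hat: "onorm ((*v) (pinv (transpose Shat))) = \<Delta> * onorm ((*v) X)"
    using onorm_scaleR[of "(*v) X" \<Delta>] \<open>0 < \<Delta>\<close>
    by (simp add: scaleR_matrix_vector_assoc)
  have "norm (?P ?C - ?P ?G) \<le> onorm ((*v) X) * norm e"
    unfolding diff by (rule onorm) auto
  also have "\<dots> \<le> onorm ((*v) X) * (sqrt (real CARD('m)) * (L / 6 * \<Delta> ^ 3))"
    by (intro mult_left_mono norm_e onorm_pos_le) auto
  also have "\<dots> = L * sqrt (real CARD('m)) / 6 * onorm ((*v) (pinv (transpose Shat))) * \<Delta>\<^sup>2"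
    by (simp add: onorm_hat power2_eq_square power3_eq_cube)
  finally show ?thesis by (simp add: restr PC)
qed

end
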